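(* There are contextuality scenarios $H$ for which $\mathcal{CE}^\infty(H)\subseteq\mathbb{R}^{V(H)}$ is not convex.
   Context: A contextuality scenario is a hypergraph $H$ with finite nonempty vertex set $V(H)$ and edge set $E(H)\subseteq 2^{V(H)}$ such that $\bigcup_{e\in E(H)}e=V(H)$. A probabilistic model on $H$ is a map $p:V(H)\to[0,1]$ with $\sum_{v\in e}p(v)=1$ for all $e\in E(H)$; $\mathcal{G}(H)$ is the set of these. The non-orthogonality graph $\mathrm{NO}(H)$ is the simple graph on $V(H)$ in which $u,v$ are adjacent iff no edge $e\in E(H)$ satisfies $\{u,v\}\subseteq e$. The Foulis–Randall product $H_A\otimes H_B$ has vertex set $V(H_A)\times V(H_B)$ and as edges all sets $\bigcup_{a\in e_A}\{a\}\times f(a)$ with $e_A\in E(H_A)$, $f:e_A\to E(H_B)$, and all sets $\bigcup_{b\in e_B}f(b)\times\{b\}$ with $e_B\in E(H_B)$, $f:e_B\to E(H_A)$. $H^{\otimes n}$ is the iterated binary Foulis–Randall product of $n$ copies of $H$ (with any fixed bracketing), with vertex set identified with $V(H)^n$, and $p^{\otimes n}(v_1,\dots,v_n)=p(v_1)\cdots p(v_n)$. $\mathcal{CE}^1(H)$ is the set of $p\in\mathcal{G}(H)$ with $\sum_{v\in I}p(v)\leq 1$ for every independent set $I$ of $\mathrm{NO}(H)$. $p\in\mathcal{CE}^n(H)$ iff $p^{\otimes n}\in\mathcal{CE}^1(H^{\otimes n})$; $\mathcal{CE}^\infty(H)=\bigcap_{n\geq1}\mathcal{CE}^n(H)$.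 *)

theory Defs
  imports "HOL-Analysis.Analysis" "HOL-Library.Function_Algebras"
begin

text \<open>
  Pointwise scalar multiplication makes the functions into a real vector space, so that
  the library predicate \<open>convex\<close> applies to sets of functions on the vertices of a scenario.
\<close>

instantiation "fun" :: (type, real_vector) real_vector
begin

definition scaleR_fun :: "real \<Rightarrow> ('a \<Rightarrow> 'b) \<Rightarrow> 'a \<Rightarrow> 'b"
  where "scaleR_fun r f = (\<lambda>x. r *\<^sub>R f x)"

instance
  by standard
    (auto simp: scaleR_fun_def plus_fun_def fun_eq_iff scaleR_add_right scaleR_add_left)

end

record 'v hypergraph =
  vertices :: "'v set"
  hedges :: "'v set set"

definition contextuality_scenario :: "'v hypergraph \<Rightarrow> bool" where
  "contextuality_scenario H \<longleftrightarrow>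
     finite (vertices H) \<and> vertices H \<noteq> {} \<and>
     hedges H \<subseteq> Pow (vertices H) \<and> \<Union>(hedges H) = vertices H"

text \<open>
  A real function on \<open>vertices H\<close> is represented by its extension by zero to the whole
  vertex type; these extensions form the linear subspace that stands for
  \<open>\<real>\<close> to the power \<open>vertices H\<close>.
\<close>

definition prob_models :: "'v hypergraph \<Rightarrow> ('v \<Rightarrow> real) set" where
  "prob_models H =
     {p. (\<forall>v\<in>vertices H. 0 \<le> p v \<and> p v \<le> 1) \<and>
         (\<forall>v. v \<notin> vertices H \<longrightarrow> p v = 0) \<and>
         (\<forall>e\<in>hedges H. (\<Sum>v\<in>e. p v) = 1)}"

definition NO_adj :: "'v hypergraph \<Rightarrow> 'v \<Rightarrow> 'v \<Rightarrow> bool" where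
  "NO_adj H u v \<longleftrightarrow>
     u \<in> vertices H \<and> v \<in> vertices H \<and> u \<noteq> v \<and> \<not> (\<exists>e\<in>hedges H. {u, v} \<subseteq> e)"

definition NO_independent :: "'v hypergraph \<Rightarrow> 'v set \<Rightarrow> bool" where
  "NO_independent H I \<longleftrightarrow> I \<subseteq> vertices H \<and> (\<forall>u\<in>I. \<forall>v\<in>I. \<not> NO_adj H u v)"

definition FR_product :: "'a hypergraph \<Rightarrow> 'b hypergraph \<Rightarrow> ('a \<times> 'b) hypergraph" where
  "FR_product HA HB =
     \<lparr> vertices = vertices HA \<times> vertices HB,
       hedges =
         {(\<Union>a\<in>eA. {a} \<times> f a) | eA f. eA \<in> hedges HA \<and> f \<in> eA \<rightarrow> hedges HB} \<union>
         {(\<Union>b\<in>eB. f b \<times> {b}) | eB f. eB \<in> hedges HB \<and> f \<in> eB \<rightarrow> hedges HA} \<rparr>"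

definition relabel :: "('a \<Rightarrow> 'b) \<Rightarrow> 'a hypergraph \<Rightarrow> 'b hypergraph" where
  "relabel g H = \<lparr> vertices = g ` vertices H, hedges = (\<lambda>e. g ` e) ` hedges H \<rparr>"

text \<open>
  The vertices of the \<open>n\<close>-fold product are the lists of length \<open>n\<close> of vertices of \<open>H\<close>; the
  binary products are bracketed to the right.  Only \<open>n \<ge> 1\<close> is used below; the value at \<open>0\<close>
  is the one-vertex scenario.
\<close>

fun FR_power :: "'v hypergraph \<Rightarrow> nat \<Rightarrow> 'v list hypergraph" where
  "FR_power H 0 = \<lparr> vertices = {[]}, hedges = {{[]}} \<rparr>"
| "FR_power H (Suc 0) = relabel (\<lambda>v. [v]) H"
| "FR_power H (Suc (Suc n)) =
     relabel (\<lambda>(v, vs). v # vs) (FR_product H (FR_power H (Suc n)))"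

definition model_power :: "('v \<Rightarrow> real) \<Rightarrow> nat \<Rightarrow> 'v list \<Rightarrow> real" where
  "model_power p n vs = (if length vs = n then (\<Prod>i<n. p (vs ! i)) else 0)"

definition CE1 :: "'v hypergraph \<Rightarrow> ('v \<Rightarrow> real) set" where
  "CE1 H = {p \<in> prob_models H. \<forall>I. NO_independent H I \<longrightarrow> (\<Sum>v\<in>I. p v) \<le> 1}"

definition CE :: "nat \<Rightarrow> 'v hypergraph \<Rightarrow> ('v \<Rightarrow> real) set" where
  "CE n H = {p \<in> prob_models H. model_power p n \<in> CE1 (FR_power H n)}"

definition CE_inf :: "'v hypergraph \<Rightarrow> ('v \<Rightarrow> real) set" where
  "CE_inf H = (\<Inter>n\<in>{1..}. CE n H)"


lemma contextuality_scenario_FR_product: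
  assumes "contextuality_scenario HA" "contextuality_scenario HB"
  shows "contextuality_scenario (FR_product HA HB)"
proof -
  have sub: "\<Union>(hedges (FR_product HA HB)) \<subseteq> vertices (FR_product HA HB)"
  proof
    fix x assume "x \<in> \<Union>(hedges (FR_product HA HB))"
    then obtain E where E: "E \<in> hedges (FR_product HA HB)" "x \<in> E" by blast
    have sA: "\<And>e. e \<in> hedges HA \<Longrightarrow> e \<subseteq> vertices HA"
      and sB: "\<And>e. e \<in> hedges HB \<Longrightarrow> e \<subseteq> vertices HB"
      using assms by (auto simp: contextuality_scenario_def)
    from E(1) consider
        eA f where "E = (\<Union>a\<in>eA. {a} \<times> f a)" "eA \<in> hedges HA" "f \<in> eA \<rightarrow> hedges HB"
      | eB f where "E = (\<Union>b\<in>eB. f b \<times> {b})" "eB \<in> hedges HB" "f \<in> eB \<rightarrow> hedges HA"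
      unfolding FR_product_def hypergraph.simps by (elim UnE CollectE exE conjE) simp_all
    then show "x \<in> vertices (FR_product HA HB)"
    proof cases
      case 1
      with E(2) obtain a b where "x = (a, b)" "a \<in> eA" "b \<in> f a" by blast
      with 1 sA[of eA] sB[of "f a"] show ?thesis by (auto simp: FR_product_def Pi_iff)
    next
      case 2
      with E(2) obtain a b where "x = (a, b)" "b \<in> eB" "a \<in> f b" by blast
      with 2 sB[of eB] sA[of "f b"] show ?thesis by (auto simp: FR_product_def Pi_iff)
    qed
  qed
  have sup: "vertices (FR_product HA HB) \<subseteq> \<Union>(hedges (FR_product HA HB))"
  proof
    fix x assume "x \<in> vertices (FR_product HA HB)"
    then obtain a b where x: "x = (a, b)" "a \<in> vertices HA" "b \<in> vertices HB"
      by (auto simp: FR_product_def)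
    obtain eA where eA: "eA \<in> hedges HA" "a \<in> eA"
      using x assms unfolding contextuality_scenario_def by blast
    obtain eB where eB: "eB \<in> hedges HB" "b \<in> eB"
      using x assms unfolding contextuality_scenario_def by blast
    have "(\<Union>a\<in>eA. {a} \<times> (\<lambda>_. eB) a) \<in> hedges (FR_product HA HB)"
    proof -
      have "(\<lambda>_. eB) \<in> eA \<rightarrow> hedges HB" using eB by simp
      with eA(1) show ?thesis
        unfolding FR_product_def hypergraph.simps by (intro UnI1 CollectI exI conjI) (rule refl)
    qed
    moreover have "x \<in> (\<Union>a\<in>eA. {a} \<times> (\<lambda>_. eB) a)" using x eA eB by auto
    ultimately show "x \<in> \<Union>(hedges (FR_product HA HB))" by blast
  qed
  have "finite (vertices (FR_product HA HB))" "vertices (FR_product HA HB) \<noteq> {}"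
    using assms by (auto simp: contextuality_scenario_def FR_product_def)
  with sub sup show ?thesis
    unfolding contextuality_scenario_def by blast
qed

lemma contextuality_scenario_relabel:
  assumes "contextuality_scenario H"
  shows "contextuality_scenario (relabel g H)"
proof -
  have "\<Union>((\<lambda>e. g ` e) ` hedges H) = g ` \<Union>(hedges H)" by blast
  then show ?thesis
    using assms by (auto simp: contextuality_scenario_def relabel_def)
qed

lemma contextuality_scenario_FR_power:
  assumes "contextuality_scenario H"
  shows "contextuality_scenario (FR_power H n)"
  using assms
  by (induction H n rule: FR_power.induct)
    (auto intro: contextuality_scenario_relabel contextuality_scenario_FR_product
      simp: contextuality_scenario_def[of "\<lparr>vertices = _, hedges = _\<rparr>"])

lemma vertices_FR_power:
  "vertices (FR_power H n) = {vs. length vs = n \<and> set vs \<subseteq> vertices H}"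
proof (induction H n rule: FR_power.induct)
  case (3 H n)
  then show ?case
    by (auto simp: relabel_def FR_product_def length_Suc_conv image_iff)
qed (auto simp: relabel_def length_Suc_conv)

end

theory Submission
  imports Defs "HOL-Library.Z2"
begin

text \<open>
  Over a field, assign to each vertex \<open>v\<close> an idempotent of rank \<open>r v\<close> on a space of dimension \<open>d\<close>
  such that the idempotents of each edge are mutually orthogonal and sum to the identity.  Since
  ranks multiply under tensor products, \<open>r / d\<close> lies in \<open>CE_inf\<close>, as in the Haemers bound on the
  Shannon capacity.

  Call two triples in a 16-element set A-orthogonal if they meet in an even number of points and
  B-orthogonal if they meet in one point.  Indicator vectors give rank-1 idempotents on a space of
  dimension 16 for A-orthogonality over the field with two elements, and for B-orthogonality over
  the reals with the form \<open>(\<langle>a, b\<rangle> - \<langle>a, 1\<rangle>\<langle>b, 1\<rangle> / 9) / 2\<close>.  Take an A-copy and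
  a B-copy of every triple, with all A-copies orthogonal to all B-copies.  The two representations give models
  of weight \<open>1/16\<close> on one kind of copies and \<open>0\<close> on the other, so their midpoint has weight \<open>1/32\<close>
  on all copies.  As distinct triples are A- or B-orthogonal, the pairs consisting of
  the two copies of a triple, in either order, are independent in the square; their total weight
  under the midpoint is \<open>2 \<cdot> 560 / 32\<^sup>2 > 1\<close>.
\<close>

section \<open>Linear algebra: biorthogonal systems of vectors and covectors\<close>

text \<open>Encodes mutually orthogonal rank-one idempotents \<open>x a \<otimes> y a\<close> on the
  space with coordinates \<open>K\<close>. Keeping covectors \<open>y\<close> apart from vectors
  \<open>x\<close> allows any field and any bilinear form.\<close>

definition biorthogonal ::
    "'k set \<Rightarrow> 'i set \<Rightarrow> ('i \<Rightarrow> 'k \<Rightarrow> 'a::field) \<Rightarrow> ('i \<Rightarrow> 'k \<Rightarrow> 'a) \<Rightarrow> bool" where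
  "biorthogonal K A x y \<longleftrightarrow>
     (\<forall>a\<in>A. \<forall>b\<in>A. (\<Sum>c\<in>K. y a c * x b c) = (if a = b then 1 else 0))"

lemma biorthogonalD:
  "biorthogonal K A x y \<Longrightarrow> a \<in> A \<Longrightarrow> b \<in> A \<Longrightarrow>
    (\<Sum>c\<in>K. y a c * x b c) = (if a = b then 1 else 0)"
  by (simp add: biorthogonal_def)

text \<open>Pairing a vanishing combination of the \<open>x b\<close> with \<open>y a\<close>
  isolates the coefficient at \<open>a\<close>, so the vectors are linearly independent.\<close>

lemma biorthogonal_card_le:
  fixes x y :: "'i \<Rightarrow> 'k \<Rightarrow> 'a::field"
  assumes "finite A" "finite K" and xy: "biorthogonal K A x y"
  shows "card A \<le> card K"
proof -
  define sc :: "'a \<Rightarrow> ('k \<Rightarrow> 'a) \<Rightarrow> 'k \<Rightarrow> 'a" where "sc = (\<lambda>s f k. s * f k)"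
  interpret V: vector_space sc
    by standard (auto simp: sc_def fun_eq_iff algebra_simps)
  \<comment> \<open>Entries outside \<open>K\<close> are arbitrary; cutting them to 0 puts the
    vectors in the span of the unit vectors indexed by \<open>K\<close>.\<close>
  define X where "X a = (\<lambda>k. if k \<in> K then x a k else 0)" for a
  define unit :: "'k \<Rightarrow> 'k \<Rightarrow> 'a" where "unit k = (\<lambda>j. if j = k then 1 else 0)" for k
  have sum_apply: "(\<Sum>b\<in>T. f b) k = (\<Sum>b\<in>T. f b k)" for f :: "'z \<Rightarrow> 'k \<Rightarrow> 'a" and T k
    by (induction T rule: infinite_finite_induct) auto
  have pair: "(\<Sum>c\<in>K. y a c * X b c) = (if a = b then 1 else 0)" if "a \<in> A" "b \<in> A" for a b
    using biorthogonalD[OF xy that] by (simp add: X_def)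
  have inj: "inj_on X A"
  proof (rule inj_onI)
    fix a b assume ab: "a \<in> A" "b \<in> A" "X a = X b"
    then show "a = b"
      using pair[of a a] pair[of a b] by (auto split: if_splits)
  qed
  have indep: "V.independent (X ` A)"
  proof (rule V.independent_if_scalars_zero)
    fix f v assume z: "(\<Sum>v\<in>X ` A. sc (f v) v) = 0" and "v \<in> X ` A"
    then obtain a where a: "a \<in> A" "v = X a" by auto
    have "0 = (\<Sum>c\<in>K. y a c * (\<Sum>b\<in>A. sc (f (X b)) (X b)) c)"
      using z by (simp add: sum.reindex[OF inj])
    also have "\<dots> = (\<Sum>c\<in>K. \<Sum>b\<in>A. f (X b) * (y a c * X b c))"
      by (simp add: sum_apply sc_def sum_distrib_left algebra_simps)
    also have "\<dots> = (\<Sum>b\<in>A. f (X b) * (\<Sum>c\<in>K. y a c * X b c))"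
      by (subst sum.swap) (simp add: sum_distrib_left)
    also have "\<dots> = (\<Sum>b\<in>A. if a = b then f (X b) else 0)"
      using a by (intro sum.cong) (auto simp: pair)
    also have "\<dots> = f v" using a \<open>finite A\<close> by simp
    finally show "f v = 0" by simp
  qed (use \<open>finite A\<close> in simp)
  have "X a \<in> V.span (unit ` K)" for a
  proof -
    have "X a = (\<Sum>k\<in>K. sc (x a k) (unit k))"
      using \<open>finite K\<close> by (auto simp: X_def sum_apply sc_def unit_def fun_eq_iff if_distrib[of "times z" for z] cong: if_cong)
    then show ?thesis by (auto intro: V.span_sum V.span_scale V.span_base)
  qed
  then have "card (X ` A) \<le> card (unit ` K)"
    using V.independent_span_bound[OF _ indep, of "unit ` K"] \<open>finite K\<close> by auto
  also have "\<dots> \<le> card K" using \<open>finite K\<close> by (rule card_image_le)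
  finally show ?thesis by (simp add: card_image[OF inj])
qed

lemma biorthogonal_step:
  fixes x y :: "'i \<Rightarrow> 'k \<Rightarrow> 'a::field"
  assumes A: "finite A" and K: "finite K" and xy: "biorthogonal K A x y" and less: "card A < card K"
  obtains x' y' where
    "(\<Sum>c\<in>K. y' c * x' c) = 1"
    "\<And>a. a \<in> A \<Longrightarrow> (\<Sum>c\<in>K. y a c * x' c) = 0"
    "\<And>a. a \<in> A \<Longrightarrow> (\<Sum>c\<in>K. y' c * x a c) = 0"
proof -
  text \<open>The projection \<open>\<Sum>a\<in>A. x a \<otimes> y a\<close> has rank below \<open>card K\<close>, so it is not the identity.\<close>
  define P where "P j k = (\<Sum>a\<in>A. x a j * y a k)" for j k
  \<comment> \<open>\<open>P\<close> being the identity is biorthogonality with the roles of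
    \<open>A\<close> and \<open>K\<close> exchanged, which would force
    \<open>card K \<le> card A\<close>.\<close>
  have "\<not> biorthogonal A K (\<lambda>k a. y a k) (\<lambda>k a. x a k)"
    using biorthogonal_card_le[OF K A] less by (auto simp: not_le)
  then obtain i j where ij: "i \<in> K" "j \<in> K" "P i j \<noteq> (if i = j then 1 else 0)"
    by (auto simp: biorthogonal_def P_def)
  \<comment> \<open>Column \<open>j\<close> of \<open>I - P\<close>, at a position
    \<open>(i, j)\<close> where \<open>I - P\<close> is nonzero. It is killed by each
    \<open>y a\<close>, as \<open>y a\<close> is fixed by \<open>P\<close>.\<close>
  define x' where "x' k = (if k = j then 1 else 0) - P k j" for k
  have nz: "x' i \<noteq> 0" using ij by (auto simp: x'_def)
  have yx': "(\<Sum>c\<in>K. y a c * x' c) = 0" if "a \<in> A" for a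
  proof -
    have "(\<Sum>c\<in>K. y a c * P c j) = (\<Sum>b\<in>A. (\<Sum>c\<in>K. y a c * x b c) * y b j)"
      unfolding P_def sum_distrib_left sum_distrib_right by (subst sum.swap) (simp add: mult.assoc)
    also have "\<dots> = (\<Sum>b\<in>A. if a = b then y b j else 0)"
      using that by (intro sum.cong) (auto simp: biorthogonalD[OF xy])
    also have "\<dots> = y a j" using that A by simp
    finally show ?thesis
      using K ij by (simp add: x'_def right_diff_distrib sum_subtractf if_distrib[of "times z" for z] cong: if_cong)
  qed
  \<comment> \<open>Row \<open>i\<close> of \<open>I - P\<close>. Since \<open>I - P\<close> is
    idempotent, this row paired with column \<open>j\<close> gives the entry \<open>x' i\<close>,
    hence the scaling.\<close>
  define y' where "y' k = ((if k = i then 1 else 0) - P i k) / x' i" for k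
  have y'x: "(\<Sum>c\<in>K. y' c * x a c) = 0" if "a \<in> A" for a
  proof -
    have "(\<Sum>c\<in>K. P i c * x a c) = (\<Sum>b\<in>A. x b i * (\<Sum>c\<in>K. y b c * x a c))"
      unfolding P_def sum_distrib_left sum_distrib_right by (subst sum.swap) (simp add: mult.assoc)
    also have "\<dots> = (\<Sum>b\<in>A. if b = a then x b i else 0)"
      using that by (intro sum.cong) (auto simp: biorthogonalD[OF xy])
    also have "\<dots> = x a i" using that A by simp
    finally have "(\<Sum>c\<in>K. ((if c = i then 1 else 0) - P i c) * x a c) = 0"
      using K ij by (simp add: left_diff_distrib sum_subtractf if_distrib[of "\<lambda>z. z * w" for w] cong: if_cong)
    then show ?thesis by (simp add: y'_def flip: sum_divide_distrib)
  qed
  have "(\<Sum>c\<in>K. P i c * x' c) = (\<Sum>a\<in>A. x a i * (\<Sum>c\<in>K. y a c * x' c))"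
    unfolding P_def sum_distrib_left sum_distrib_right by (subst sum.swap) (simp add: mult.assoc)
  then have "(\<Sum>c\<in>K. P i c * x' c) = 0" by (simp add: yx')
  then have "(\<Sum>c\<in>K. ((if c = i then 1 else 0) - P i c) * x' c) = x' i"
    using K ij by (simp add: left_diff_distrib sum_subtractf if_distrib[of "\<lambda>z. z * w" for w] cong: if_cong)
  then have "(\<Sum>c\<in>K. y' c * x' c) = 1"
    using nz by (simp add: y'_def flip: sum_divide_distrib)
  with yx' y'x show ?thesis using that by blast
qed

text \<open>Rank-one pieces of the complement are split off one at a time. The given vectors stay
  fixed, since a vertex shared by several edges must carry the same vectors in each of them.\<close>

lemma biorthogonal_extend:
  fixes x y :: "'i \<Rightarrow> 'k \<Rightarrow> 'a::field"
  assumes A: "finite A" and K: "finite K" and xy: "biorthogonal K A x y"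
    and le: "card A + m \<le> card K"
  shows "\<exists>x' y'. biorthogonal K (A <+> {..<m::nat}) (case_sum x x') (case_sum y y')"
  using le
proof (induction m)
  case 0
  then show ?case using xy by (simp add: biorthogonal_def Plus_def)
next
  case (Suc m)
  then obtain x' y' where b: "biorthogonal K (A <+> {..<m}) (case_sum x x') (case_sum y y')"
    by auto
  have "finite (A <+> {..<m})" "card (A <+> {..<m}) < card K"
    using A Suc.prems by (auto simp: card_Plus)
  from biorthogonal_step[OF this(1) K b this(2)] obtain x1 y1 where n:
    "(\<Sum>c\<in>K. y1 c * x1 c) = 1"
    "\<And>a. a \<in> A <+> {..<m} \<Longrightarrow> (\<Sum>c\<in>K. case_sum y y' a c * x1 c) = 0"
    "\<And>a. a \<in> A <+> {..<m} \<Longrightarrow> (\<Sum>c\<in>K. y1 c * case_sum x x' a c) = 0"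
    by metis
  have nl: "(\<Sum>c\<in>K. y a c * x1 c) = 0" "(\<Sum>c\<in>K. y1 c * x a c) = 0" if "a \<in> A" for a
    using n(2,3)[of "Inl a"] that by auto
  have nr: "(\<Sum>c\<in>K. y' i c * x1 c) = 0" "(\<Sum>c\<in>K. y1 c * x' i c) = 0" if "i < m" for i
    using n(2,3)[of "Inr i"] that by auto
  have "biorthogonal K (A <+> {..<Suc m}) (case_sum x (x'(m := x1))) (case_sum y (y'(m := y1)))"
    unfolding biorthogonal_def
  proof (intro ballI)
    fix a b assume ab: "a \<in> A <+> {..<Suc m}" "b \<in> A <+> {..<Suc m}"
    have lift: "a = Inr m \<or> a \<in> A <+> {..<m}" if "a \<in> A <+> {..<Suc m}" for a
      using that by auto
    have old: "case_sum x (x'(m := x1)) a = case_sum x x' a" "case_sum y (y'(m := y1)) a = case_sum y y' a"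
      if "a \<in> A <+> {..<m}" for a
      using that by auto
    show "(\<Sum>c\<in>K. case_sum y (y'(m := y1)) a c * case_sum x (x'(m := x1)) b c) = (if a = b then 1 else 0)"
      using lift[OF ab(1)] lift[OF ab(2)] n(1)
      by (elim disjE) (auto simp: old biorthogonalD[OF b] nl nr)
  qed
  then show ?case by blast
qed

section \<open>Exclusivity in Foulis-Randall products and powers\<close>

text \<open>The orthogonality graph, complementary to \<open>NO_adj\<close> on the vertices;
  independent sets of the latter become cliques.\<close>

definition exclusive :: "'v hypergraph \<Rightarrow> 'v \<Rightarrow> 'v \<Rightarrow> bool" where
  "exclusive H u v \<longleftrightarrow> u \<noteq> v \<and> (\<exists>e\<in>hedges H. {u, v} \<subseteq> e)"

lemma exclusiveI: "e \<in> hedges H \<Longrightarrow> u \<in> e \<Longrightarrow> v \<in> e \<Longrightarrow> u \<noteq> v \<Longrightarrow> exclusive H u v"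
  by (auto simp: exclusive_def)

lemma scenarioD:
  assumes "contextuality_scenario H"
  shows "finite (vertices H)" "e \<in> hedges H \<Longrightarrow> e \<subseteq> vertices H" "e \<in> hedges H \<Longrightarrow> finite e"
    "v \<in> vertices H \<Longrightarrow> \<exists>e\<in>hedges H. v \<in> e"
  using assms by (auto simp: contextuality_scenario_def dest: finite_subset)

lemma NO_independent_iff:
  "NO_independent H I \<longleftrightarrow> I \<subseteq> vertices H \<and> (\<forall>u\<in>I. \<forall>v\<in>I. u \<noteq> v \<longrightarrow> exclusive H u v)"
proof -
  have "\<not> NO_adj H u v \<longleftrightarrow> (u \<noteq> v \<longrightarrow> exclusive H u v)" if "u \<in> vertices H" "v \<in> vertices H" for u v
    using that by (auto simp: NO_adj_def exclusive_def)
  then show ?thesis unfolding NO_independent_def by (meson subsetD)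
qed

text \<open>An edge is a two-stage measurement: two of its outcomes differ at the first stage, or
  agree there and differ in the common second-stage edge. Hence non-orthogonality graphs multiply by
  the strong product, as for Shannon capacity.\<close>

lemma exclusive_FR_product:
  assumes HA: "contextuality_scenario HA" and HB: "contextuality_scenario HB"
  shows "exclusive (FR_product HA HB) (a, b) (a', b') \<longleftrightarrow>
    a \<in> vertices HA \<and> a' \<in> vertices HA \<and> b \<in> vertices HB \<and> b' \<in> vertices HB \<and>
    (exclusive HA a a' \<or> exclusive HB b b')" (is "?L \<longleftrightarrow> ?R")
proof
  assume L: ?L
  then obtain E where E: "E \<in> hedges (FR_product HA HB)" "(a, b) \<in> E" "(a', b') \<in> E"
    and ne: "(a, b) \<noteq> (a', b')"
    by (auto simp: exclusive_def)
  have "E \<subseteq> vertices (FR_product HA HB)"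
    using scenarioD(2)[OF contextuality_scenario_FR_product[OF HA HB] E(1)] .
  then have "a \<in> vertices HA" "a' \<in> vertices HA" "b \<in> vertices HB" "b' \<in> vertices HB"
    using E by (auto simp: FR_product_def)
  moreover have "exclusive HA a a' \<or> exclusive HB b b'"
  proof -
    from E(1) consider
        eA f where "E = (\<Union>a\<in>eA. {a} \<times> f a)" "eA \<in> hedges HA" "f \<in> eA \<rightarrow> hedges HB"
      | eB f where "E = (\<Union>b\<in>eB. f b \<times> {b})" "eB \<in> hedges HB" "f \<in> eB \<rightarrow> hedges HA"
      unfolding FR_product_def hypergraph.simps by (elim UnE CollectE exE conjE) simp_all
    then show ?thesis
    proof cases
      case 1
      with E have "a \<in> eA" "b \<in> f a" "a' \<in> eA" "b' \<in> f a'" by auto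
      with 1 ne show ?thesis by (cases "a = a'") (auto simp: exclusive_def Pi_iff)
    next
      case 2
      with E have "b \<in> eB" "a \<in> f b" "b' \<in> eB" "a' \<in> f b'" by auto
      with 2 ne show ?thesis by (cases "b = b'") (auto simp: exclusive_def Pi_iff)
    qed
  qed
  ultimately show ?R by blast
next
  assume R: ?R
  obtain gA where gA: "\<And>v. v \<in> vertices HA \<Longrightarrow> gA v \<in> hedges HA \<and> v \<in> gA v"
    using scenarioD(4)[OF HA] by metis
  obtain gB where gB: "\<And>v. v \<in> vertices HB \<Longrightarrow> gB v \<in> hedges HB \<and> v \<in> gB v"
    using scenarioD(4)[OF HB] by metis
  have mem: "gA a \<in> hedges HA" "a \<in> gA a" "gA a' \<in> hedges HA" "a' \<in> gA a'"
    "gB b \<in> hedges HB" "b \<in> gB b" "gB b' \<in> hedges HB" "b' \<in> gB b'"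
    using R gA gB by blast+
  from R consider "exclusive HA a a'" | "exclusive HB b b'" by blast
  then show ?L
  proof cases
    case 1
    then obtain e where e: "e \<in> hedges HA" "a \<in> e" "a' \<in> e" "a \<noteq> a'"
      unfolding exclusive_def by blast
    \<comment> \<open>Outcome \<open>a\<close> is answered by an edge through \<open>b\<close>,
      every other outcome, in particular \<open>a'\<close>, by an edge through
      \<open>b'\<close>.\<close>
    let ?f = "\<lambda>z. if z = a then gB b else gB b'"
    have "(\<Union>z\<in>e. {z} \<times> ?f z) \<in> hedges (FR_product HA HB)"
    proof -
      have "?f \<in> e \<rightarrow> hedges HB" using mem by auto
      with e(1) show ?thesis
        unfolding FR_product_def hypergraph.simps by (intro UnI1 CollectI exI conjI) (rule refl)
    qed
    moreover have "(a, b) \<in> (\<Union>z\<in>e. {z} \<times> ?f z)" "(a', b') \<in> (\<Union>z\<in>e. {z} \<times> ?f z)"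
      using e mem by simp_all
    ultimately show ?L
      by (rule exclusiveI) (use e in simp)
  next
    case 2
    then obtain e where e: "e \<in> hedges HB" "b \<in> e" "b' \<in> e" "b \<noteq> b'"
      unfolding exclusive_def by blast
    let ?f = "\<lambda>z. if z = b then gA a else gA a'"
    have "(\<Union>z\<in>e. ?f z \<times> {z}) \<in> hedges (FR_product HA HB)"
    proof -
      have "?f \<in> e \<rightarrow> hedges HA" using mem by auto
      with e(1) show ?thesis
        unfolding FR_product_def hypergraph.simps by (intro UnI2 CollectI exI conjI) (rule refl)
    qed
    moreover have "(a, b) \<in> (\<Union>z\<in>e. ?f z \<times> {z})" "(a', b') \<in> (\<Union>z\<in>e. ?f z \<times> {z})"
      using e mem by simp_all
    ultimately show ?L
      by (rule exclusiveI) (use e in simp)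
  qed
qed

lemma exclusive_relabel:
  assumes H: "contextuality_scenario H" and g: "inj_on g (vertices H)"
    and uv: "u \<in> vertices H" "v \<in> vertices H"
  shows "exclusive (relabel g H) (g u) (g v) \<longleftrightarrow> exclusive H u v"
proof -
  have "g w \<in> g ` e \<longleftrightarrow> w \<in> e" if "e \<in> hedges H" "w \<in> vertices H" for e w
    using inj_on_image_mem_iff[OF g that(2) scenarioD(2)[OF H that(1)]] .
  then show ?thesis
    using uv inj_onD[OF g] by (auto simp: exclusive_def relabel_def)
qed

lemma inj_case_Cons: "inj_on (\<lambda>(v, vs). v # vs) A"
  by (auto simp: inj_on_def)

lemma exclusive_FR_power:
  assumes H: "contextuality_scenario H"
  shows "us \<in> vertices (FR_power H n) \<Longrightarrow> vs \<in> vertices (FR_power H n) \<Longrightarrow>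
    exclusive (FR_power H n) us vs \<longleftrightarrow> (\<exists>k<n. exclusive H (us ! k) (vs ! k))"
  using H
proof (induction H n arbitrary: us vs rule: FR_power.induct)
  case (1 H)
  then show ?case by (auto simp: exclusive_def)
next
  case (2 H)
  then obtain u v where uv: "us = [u]" "vs = [v]" "u \<in> vertices H" "v \<in> vertices H"
    by (auto simp: relabel_def)
  then show ?case
    using exclusive_relabel[of H "\<lambda>v. [v]" u v] 2(3) by (auto simp: inj_on_def)
next
  case (3 H n)
  let ?P = "FR_power H (Suc n)"
  note H = 3(4)
  have P: "contextuality_scenario ?P" using contextuality_scenario_FR_power[OF H] .
  note HP = contextuality_scenario_FR_product[OF H P]
  from 3 obtain u us' v vs' where uv: "us = u # us'" "vs = v # vs'"
    and mem: "u \<in> vertices H" "v \<in> vertices H" "us' \<in> vertices ?P" "vs' \<in> vertices ?P"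
    by (auto simp: relabel_def FR_product_def)
  have "exclusive (FR_power H (Suc (Suc n))) us vs
      \<longleftrightarrow> exclusive (FR_product H ?P) (u, us') (v, vs')"
    using exclusive_relabel[OF HP inj_case_Cons, of "(u, us')" "(v, vs')"] mem
    by (simp add: uv FR_product_def)
  also have "\<dots> \<longleftrightarrow> exclusive H u v \<or> exclusive ?P us' vs'"
    using mem by (simp add: exclusive_FR_product[OF H P])
  also have "exclusive ?P us' vs' \<longleftrightarrow> (\<exists>k<Suc n. exclusive H (us' ! k) (vs' ! k))"
    using 3(1)[OF mem(3,4) H] .
  also have "exclusive H u v \<or> \<dots> \<longleftrightarrow> (\<exists>k<Suc (Suc n). exclusive H (us ! k) (vs ! k))"
    unfolding uv ex_simps by (subst Ex_less_Suc2) simp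
  finally show ?case .
qed

section \<open>Product models are probabilistic models\<close>

text \<open>Summing over the second stage first, every response edge contributes 1, which leaves the
  weight of the first-stage edge.\<close>

lemma prob_models_FR_product:
  assumes HA: "contextuality_scenario HA" and HB: "contextuality_scenario HB"
    and p: "p \<in> prob_models HA" and q: "q \<in> prob_models HB"
  shows "(\<lambda>(a, b). p a * q b) \<in> prob_models (FR_product HA HB)"
proof -
  have pe: "sum p e = 1" if "e \<in> hedges HA" for e using p that by (auto simp: prob_models_def)
  have qe: "sum q e = 1" if "e \<in> hedges HB" for e using q that by (auto simp: prob_models_def)
  have "(\<Sum>(a, b)\<in>E. p a * q b) = 1" if "E \<in> hedges (FR_product HA HB)" for E
  proof -
    from that consider
        eA f where "E = (\<Union>a\<in>eA. {a} \<times> f a)" "eA \<in> hedges HA" "f \<in> eA \<rightarrow> hedges HB"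
      | eB f where "E = (\<Union>b\<in>eB. f b \<times> {b})" "eB \<in> hedges HB" "f \<in> eB \<rightarrow> hedges HA"
      unfolding FR_product_def hypergraph.simps by (elim UnE CollectE exE conjE) simp_all
    then show ?thesis
    proof cases
      case 1
      then have fe: "f a \<in> hedges HB" if "a \<in> eA" for a using that by auto
      have "(\<Sum>(a, b)\<in>E. p a * q b) = (\<Sum>a\<in>eA. \<Sum>b\<in>f a. p a * q b)"
        unfolding 1 using scenarioD(3)[OF HA 1(2)] scenarioD(3)[OF HB fe]
        by (subst sum.UNION_disjoint) (auto simp: sum.cartesian_product[symmetric])
      also have "\<dots> = 1"
        using pe[OF 1(2)] by (simp add: sum_distrib_left[symmetric] qe[OF fe])
      finally show ?thesis .
    next
      case 2
      then have fe: "f b \<in> hedges HA" if "b \<in> eB" for b using that by auto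
      have "(\<Sum>(a, b)\<in>E. p a * q b) = (\<Sum>b\<in>eB. \<Sum>a\<in>f b. p a * q b)"
        unfolding 2 using scenarioD(3)[OF HB 2(2)] scenarioD(3)[OF HA fe]
        by (subst sum.UNION_disjoint) (auto simp: sum.cartesian_product[symmetric])
      also have "\<dots> = 1"
        using qe[OF 2(2)] by (simp add: sum_distrib_right[symmetric] pe[OF fe])
      finally show ?thesis .
    qed
  qed
  moreover have "0 \<le> p a * q b \<and> p a * q b \<le> 1" if "a \<in> vertices HA" "b \<in> vertices HB" for a b
    using that p q by (auto simp: prob_models_def intro: mult_le_one)
  ultimately show ?thesis
    using p q by (auto simp: prob_models_def FR_product_def)
qed

text \<open>The pullback is cut to 0 off \<open>vertices H\<close>, where models must vanish but
  \<open>p (g v)\<close> need not.\<close>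

lemma prob_models_relabel:
  assumes H: "contextuality_scenario H" and g: "inj_on g (vertices H)"
    and p: "(\<lambda>v. if v \<in> vertices H then p (g v) else 0) \<in> prob_models H"
    and out: "\<And>w. w \<notin> g ` vertices H \<Longrightarrow> p w = 0"
  shows "p \<in> prob_models (relabel g H)"
proof -
  have "sum p (g ` e) = 1" if e: "e \<in> hedges H" for e
  proof -
    have sub: "e \<subseteq> vertices H" using scenarioD(2)[OF H e] .
    have "sum p (g ` e) = (\<Sum>v\<in>e. if v \<in> vertices H then p (g v) else 0)"
      using sub by (subst sum.reindex[OF inj_on_subset[OF g sub]]) (auto intro!: sum.cong)
    also have "\<dots> = 1" using p e by (auto simp: prob_models_def)
    finally show ?thesis .
  qed
  moreover have "0 \<le> p (g v) \<and> p (g v) \<le> 1" if "v \<in> vertices H" for v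
    using p that by (auto simp: prob_models_def)
  ultimately show ?thesis using out by (auto simp: prob_models_def relabel_def)
qed

lemma model_power_Cons: "model_power p (Suc n) (v # vs) = p v * model_power p n vs"
  by (auto simp: model_power_def prod.lessThan_Suc_shift simp del: prod.lessThan_Suc)

lemma prob_models_FR_power:
  assumes "contextuality_scenario H" "p \<in> prob_models H"
  shows "model_power p n \<in> prob_models (FR_power H n)"
  using assms
proof (induction H n rule: FR_power.induct)
  case (1 H)
  then show ?case by (auto simp: prob_models_def model_power_def)
next
  case (2 H)
  have "(\<lambda>v. if v \<in> vertices H then model_power p (Suc 0) [v] else 0) = p"
    using 2 by (auto simp: model_power_def prob_models_def)
  moreover have "model_power p (Suc 0) w = 0" if "w \<notin> (\<lambda>v. [v]) ` vertices H" for w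
    using that 2 by (cases w) (auto simp: model_power_def prob_models_def image_iff)
  ultimately show ?case
    using 2 by (auto intro!: prob_models_relabel simp: inj_on_def)
next
  case (3 H n)
  let ?P = "FR_power H (Suc n)"
  have P: "contextuality_scenario ?P" using contextuality_scenario_FR_power[OF 3(2)] .
  have IH: "model_power p (Suc n) \<in> prob_models ?P" using 3 by blast
  note HP = prob_models_FR_product[OF 3(2) P 3(3) IH]
  have "(\<lambda>w. if w \<in> vertices (FR_product H ?P)
      then model_power p (Suc (Suc n)) (case w of (v, vs) \<Rightarrow> v # vs) else 0)
    = (\<lambda>(v, vs). p v * model_power p (Suc n) vs)"
    using 3(3) IH
    by (auto simp: fun_eq_iff model_power_Cons FR_product_def prob_models_def)
  moreover have "model_power p (Suc (Suc n)) w = 0"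
    if "w \<notin> (\<lambda>(v, vs). v # vs) ` vertices (FR_product H ?P)" for w
  proof (cases w)
    case Nil
    then show ?thesis by (simp add: model_power_def)
  next
    case (Cons v vs)
    with that have "v \<notin> vertices H \<or> vs \<notin> vertices ?P" by (force simp: FR_product_def)
    then show ?thesis
      using Cons 3(3) IH by (auto simp: model_power_Cons prob_models_def)
  qed
  ultimately show ?case
    using HP contextuality_scenario_FR_product[OF 3(2) P]
    by (auto intro!: prob_models_relabel inj_case_Cons)
qed

section \<open>The Haemers-type bound\<close>

text \<open>The vectors depend on the vertex alone, not on the edge. Tensoring them along the words
  of an independent set gives a biorthogonal system in dimension \<open>card K ^ n\<close>, as
  distinct words have exclusive letters in some position. Its size is the sum of the products of
  ranks; dividing by the dimension gives the required inequality.\<close>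

lemma CE_inf_if_biorthogonal:
  fixes x y :: "'v \<Rightarrow> nat \<Rightarrow> 'k \<Rightarrow> 'a::field"
  assumes H: "contextuality_scenario H" and K: "finite K" "K \<noteq> {}"
    and rank: "\<And>e. e \<in> hedges H \<Longrightarrow> (\<Sum>v\<in>e. r v) = card K"
    and bi: "\<And>e. e \<in> hedges H \<Longrightarrow>
      biorthogonal K (SIGMA v:e. {..<r v}) (\<lambda>(v, i). x v i) (\<lambda>(v, i). y v i)"
    and p: "\<And>v. p v = (if v \<in> vertices H then real (r v) / card K else 0)"
  shows "p \<in> CE_inf H"
proof -
  have K0: "0 < card K" using K by (simp add: card_gt_0_iff)
  have "r v \<le> card K" if v: "v \<in> vertices H" for v
  proof -
    obtain e where e: "e \<in> hedges H" "v \<in> e" using scenarioD(4)[OF H v] by blast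
    then have "r v \<le> (\<Sum>v\<in>e. r v)" using scenarioD(3)[OF H e(1)] by (intro member_le_sum) auto
    then show ?thesis using rank[OF e(1)] by simp
  qed
  moreover have "(\<Sum>v\<in>e. p v) = 1" if e: "e \<in> hedges H" for e
  proof -
    have "(\<Sum>v\<in>e. p v) = (\<Sum>v\<in>e. real (r v) / card K)"
      using scenarioD(2)[OF H e] by (intro sum.cong) (auto simp: p)
    also have "\<dots> = real (\<Sum>v\<in>e. r v) / card K" by (simp add: sum_divide_distrib)
    also have "\<dots> = 1" using K0 by (simp add: rank[OF e])
    finally show ?thesis .
  qed
  ultimately have pm: "p \<in> prob_models H" using K0 by (auto simp: prob_models_def p)
  have "(\<Sum>vs\<in>I. model_power p n vs) \<le> 1" if I: "NO_independent (FR_power H n) I" for n I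
  proof -
    have IV: "I \<subseteq> vertices (FR_power H n)" using I unfolding NO_independent_iff by blast
    have ex: "\<exists>k<n. exclusive H (us ! k) (vs ! k)" if "us \<in> I" "vs \<in> I" "us \<noteq> vs" for us vs
      using I that exclusive_FR_power[OF H, of us n vs] unfolding NO_independent_iff by blast
    from IV have finI: "finite I"
      using scenarioD(1)[OF contextuality_scenario_FR_power[OF H]] finite_subset by blast
    have vert: "length vs = n" "k < n \<Longrightarrow> vs ! k \<in> vertices H" if "vs \<in> I" for vs k
      using IV that by (auto simp: vertices_FR_power subset_iff)
    \<comment> \<open>\<open>Kn\<close> indexes the coordinates of the tensor power;
      \<open>M\<close> indexes the tensors, by a word together with a choice of one vector at each
      of its letters.\<close>
    define Kn where "Kn = ({..<n} \<rightarrow>\<^sub>E K)"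
    define M where "M = (SIGMA vs:I. (\<Pi>\<^sub>E k\<in>{..<n}. {..<r (vs ! k)}))"
    define X where "X = (\<lambda>(vs, i) c. \<Prod>k<n. x (vs ! k) (i k) (c k))"
    define Y where "Y = (\<lambda>(vs, i) c. \<Prod>k<n. y (vs ! k) (i k) (c k))"
    have finM: "finite M" unfolding M_def using finI by (intro finite_SigmaI finite_PiE) auto
    have "biorthogonal Kn M X Y"
      unfolding biorthogonal_def
    proof (intro ballI)
      fix a b assume ab: "a \<in> M" "b \<in> M"
      obtain us i where a: "a = (us, i)" by (cases a)
      obtain vs j where b: "b = (vs, j)" by (cases b)
      have I': "us \<in> I" "vs \<in> I" and ij: "i \<in> (\<Pi>\<^sub>E k\<in>{..<n}. {..<r (us ! k)})" "j \<in> (\<Pi>\<^sub>E k\<in>{..<n}. {..<r (vs ! k)})"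
        using ab by (auto simp: a b M_def)
      have ijk: "i k < r (us ! k)" "j k < r (vs ! k)" if "k < n" for k
        using ij that by (auto dest!: PiE_mem)
      define F where "F k = (\<Sum>c\<in>K. y (us ! k) (i k) c * x (vs ! k) (j k) c)" for k
      \<comment> \<open>An edge containing both letters turns the factor into a Kronecker delta.
        Such an edge exists when the letters are equal or exclusive, and only these cases occur
        below.\<close>
      have F: "F k = (if (us ! k, i k) = (vs ! k, j k) then 1 else 0)"
        if "k < n" "e \<in> hedges H" "us ! k \<in> e" "vs ! k \<in> e" for k e
        using biorthogonalD[OF bi[OF that(2)], of "(us ! k, i k)" "(vs ! k, j k)"] that ijk[OF that(1)]
        by (simp add: F_def)
      \<comment> \<open>The pairing of two pure tensors is the product of the pairings of their
        factors.\<close>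
      have "(\<Sum>c\<in>Kn. Y a c * X b c) = (\<Prod>k<n. F k)"
        unfolding F_def Kn_def using K(1)
        by (subst prod_sum_PiE) (auto simp: X_def Y_def a b prod.distrib)
      also have "\<dots> = (if a = b then 1 else 0)"
      proof (cases "us = vs")
        case True
        have Fk: "F k = (if i k = j k then 1 else 0)" if kn: "k < n" for k
        proof -
          obtain e where "e \<in> hedges H" "us ! k \<in> e"
            using scenarioD(4)[OF H vert(2)[OF I'(1) kn]] by blast
          then show ?thesis using F[OF kn, of e] True by simp
        qed
        show ?thesis
        proof (cases "i = j")
          case True
          then show ?thesis using \<open>us = vs\<close> by (simp add: a b Fk)
        next
          case False
          \<comment> \<open>Extensional functions that agree at all \<open>k < n\<close> are
            equal.\<close>
          have "\<exists>k<n. i k \<noteq> j k"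
          proof (rule ccontr)
            assume "\<not> ?thesis"
            then have "i = j" using ij by (intro PiE_ext[of i _ _ j]) (auto simp: True)
            then show False using False by simp
          qed
          then have "(\<Prod>k<n. F k) = 0" using Fk by (auto intro!: prod_zero)
          then show ?thesis using False by (simp add: a b)
        qed
      next
        case False
        then obtain k where k: "k < n" "exclusive H (us ! k) (vs ! k)"
          using ex I' by blast
        then obtain e where "e \<in> hedges H" "us ! k \<in> e" "vs ! k \<in> e" "us ! k \<noteq> vs ! k"
          unfolding exclusive_def by blast
        then have "F k = 0" using F[OF k(1)] by simp
        then have "(\<Prod>k<n. F k) = 0" using k by (auto intro!: prod_zero)
        then show ?thesis using False by (simp add: a b)
      qed
      finally show "(\<Sum>c\<in>Kn. Y a c * X b c) = (if a = b then 1 else 0)" .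
    qed
    then have "card M \<le> card Kn"
      using finM K(1) by (intro biorthogonal_card_le) (auto simp: Kn_def intro!: finite_PiE)
    also have "card Kn = card K ^ n" by (simp add: Kn_def card_PiE)
    also have "card M = (\<Sum>vs\<in>I. \<Prod>k<n. r (vs ! k))"
      unfolding M_def using finI by (subst card_SigmaI) (auto simp: card_PiE intro!: finite_PiE)
    finally have le: "(\<Sum>vs\<in>I. \<Prod>k<n. r (vs ! k)) \<le> card K ^ n" .
    have "model_power p n vs = real (\<Prod>k<n. r (vs ! k)) / card K ^ n" if "vs \<in> I" for vs
      using vert[OF that] by (simp add: model_power_def p prod_dividef)
    then have "(\<Sum>vs\<in>I. model_power p n vs) = real (\<Sum>vs\<in>I. \<Prod>k<n. r (vs ! k)) / real (card K ^ n)"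
      by (simp add: sum_divide_distrib)
    also have "\<dots> \<le> 1"
      using le K0 by (subst divide_le_eq_1_pos) (simp_all only: of_nat_le_iff of_nat_0_less_iff zero_less_power)
    finally show ?thesis .
  qed
  then show ?thesis
    using pm prob_models_FR_power[OF H pm] by (auto simp: CE_inf_def CE_def CE1_def)
qed

text \<open>Carries the bound from a scenario with structured vertices to a copy with other labels,
  by pulling ranks and vectors back along the inverse of \<open>g\<close>.\<close>

lemma CE_inf_relabel_if_biorthogonal:
  fixes x y :: "'v \<Rightarrow> nat \<Rightarrow> 'k \<Rightarrow> 'a::field"
  assumes H: "contextuality_scenario H" and g: "inj_on g (vertices H)"
    and K: "finite K" "K \<noteq> {}"
    and rank: "\<And>e. e \<in> hedges H \<Longrightarrow> (\<Sum>v\<in>e. r v) = card K"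
    and bi: "\<And>e. e \<in> hedges H \<Longrightarrow>
      biorthogonal K (SIGMA v:e. {..<r v}) (\<lambda>(v, i). x v i) (\<lambda>(v, i). y v i)"
  shows "\<exists>p\<in>CE_inf (relabel g H). \<forall>v\<in>vertices H. p (g v) = real (r v) / card K"
proof -
  define h where "h = inv_into (vertices H) g"
  have hg: "h (g v) = v" if "v \<in> vertices H" for v using g that by (simp add: h_def)
  define p where "p w = (if w \<in> vertices (relabel g H) then real (r (h w)) / card K else 0)" for w
  have "p \<in> CE_inf (relabel g H)"
  proof (rule CE_inf_if_biorthogonal[OF contextuality_scenario_relabel[OF H] K _ _ p_def])
    fix e' assume "e' \<in> hedges (relabel g H)"
    then obtain e where e: "e \<in> hedges H" "e' = g ` e" by (auto simp: relabel_def)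
    have sub: "e \<subseteq> vertices H" using scenarioD(2)[OF H e(1)] .
    have "(\<Sum>w\<in>e'. r (h w)) = (\<Sum>v\<in>e. r (h (g v)))"
      unfolding e(2) by (simp add: sum.reindex[OF inj_on_subset[OF g sub]])
    also have "\<dots> = (\<Sum>v\<in>e. r v)" using sub by (intro sum.cong) (auto simp: hg)
    finally show "(\<Sum>w\<in>e'. r (h w)) = card K" by (simp add: rank[OF e(1)])
    show "biorthogonal K (SIGMA w:e'. {..<r (h w)}) (\<lambda>(w, i). x (h w) i) (\<lambda>(w, i). y (h w) i)"
      unfolding biorthogonal_def
    proof (intro ballI)
      fix a b assume "a \<in> (SIGMA w:e'. {..<r (h w)})" "b \<in> (SIGMA w:e'. {..<r (h w)})"
      then obtain u i v j where ab: "a = (g u, i)" "b = (g v, j)" "u \<in> e" "v \<in> e"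
        and "i < r (h (g u))" "j < r (h (g v))"
        by (auto simp: e(2))
      moreover have uv: "h (g u) = u" "h (g v) = v" using sub ab by (auto simp: hg)
      ultimately have "(\<Sum>c\<in>K. y u i c * x v j c) = (if (u, i) = (v, j) then 1 else 0)"
        using biorthogonalD[OF bi[OF e(1)], of "(u, i)" "(v, j)"] by simp
      moreover have "g u = g v \<longleftrightarrow> u = v" using uv by metis
      ultimately show "(\<Sum>c\<in>K. (case a of (w, i) \<Rightarrow> y (h w) i) c * (case b of (w, i) \<Rightarrow> x (h w) i) c)
          = (if a = b then 1 else 0)"
        by (simp add: ab uv)
    qed
  qed
  moreover have "\<forall>v\<in>vertices H. p (g v) = real (r v) / card K"
    by (simp add: p_def relabel_def hg)
  ultimately show ?thesis by blast
qed

section \<open>Completing an orthogonality relation to a scenario\<close>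

text \<open>
  The vertex \<open>(u, u)\<close> stands for \<open>u\<close>; the vertex \<open>(u, v)\<close> with \<open>u \<noteq> v\<close> carries the weight that
  is missing from the edge containing \<open>u\<close> and \<open>v\<close>.
\<close>

definition pair_scenario :: "'b set \<Rightarrow> ('b \<times> 'b) set \<Rightarrow> ('b \<times> 'b) hypergraph" where
  "pair_scenario B R =
     \<lparr> vertices = Id_on B \<union> R, hedges = (\<lambda>(u, v). {(u, u), (v, v), (u, v)}) ` R \<rparr>"

lemma contextuality_scenario_pair_scenario:
  assumes "finite B" "B \<noteq> {}" "R \<subseteq> B \<times> B" "B \<subseteq> Domain R"
  shows "contextuality_scenario (pair_scenario B R)"
proof -
  have "finite R" using assms finite_subset by blast
  moreover have "Id_on B \<subseteq> \<Union>((\<lambda>(u, v). {(u, u), (v, v), (u, v)}) ` R)"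
    using assms(4) by fastforce
  moreover have "R \<subseteq> \<Union>((\<lambda>(u, v). {(u, u), (v, v), (u, v)}) ` R)" by force
  moreover have "\<Union>((\<lambda>(u, v). {(u, u), (v, v), (u, v)}) ` R) \<subseteq> Id_on B \<union> R"
    using assms(3) by auto
  moreover have "finite (Id_on B)" using assms(1) by (simp add: Id_on_def)
  moreover have "Id_on B \<noteq> {}" using assms(2) by (auto simp: Id_on_def)
  ultimately show ?thesis
    unfolding contextuality_scenario_def pair_scenario_def hypergraph.simps by blast
qed

text \<open>Diagonal vertices get rank 1 on \<open>S\<close> and rank 0 off \<open>S\<close>. The
  filler vertex \<open>(u, v)\<close> lies in one edge only, so its vectors can be chosen for that
  edge alone by \<open>biorthogonal_extend\<close>.\<close>

lemma CE_inf_pair_scenario: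
  fixes x y :: "'b \<Rightarrow> 'k \<Rightarrow> 'a::field"
  assumes BR: "finite B" "B \<noteq> {}" "R \<subseteq> B \<times> B" "B \<subseteq> Domain R" "irrefl R"
    and g: "inj_on g (vertices (pair_scenario B R))"
    and K: "finite K" "2 \<le> card K"
    and xy: "\<And>u v. (u, v) \<in> R \<Longrightarrow> biorthogonal K ({u, v} \<inter> S) x y"
  shows "\<exists>p\<in>CE_inf (relabel g (pair_scenario B R)).
    \<forall>u\<in>B. p (g (u, u)) = (if u \<in> S then 1 / card K else 0)"
proof -
  \<comment> \<open>Missing rank of the edge; \<open>2 \<le> card K\<close> makes the natural-number
    subtraction exact.\<close>
  let ?m = "\<lambda>u v. card K - card ({u, v} \<inter> S)"
  have cardS: "card ({u, v} \<inter> S) \<le> 2" for u v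
    by (rule order.trans[OF card_mono[of "{u, v}"]]) (auto simp: card_insert_if)
  have "\<exists>x' y'. biorthogonal K (({u, v} \<inter> S) <+> {..<?m u v}) (case_sum x x') (case_sum y y')"
    if "(u, v) \<in> R" for u v
    using cardS[of u v] K by (intro biorthogonal_extend xy that) auto
  then obtain x' y' where ext: "\<And>u v. (u, v) \<in> R \<Longrightarrow>
      biorthogonal K (({u, v} \<inter> S) <+> {..<?m u v}) (case_sum x (x' u v)) (case_sum y (y' u v))"
    by metis
  define r where "r = (\<lambda>(u, v). if u = v then of_bool (u \<in> S) else ?m u v)"
  define X where "X = (\<lambda>(u, v) i. if u = v then x u else x' u v i)"
  define Y where "Y = (\<lambda>(u, v) i. if u = v then y u else y' u v i)"
  have "\<exists>p\<in>CE_inf (relabel g (pair_scenario B R)). \<forall>w\<in>vertices (pair_scenario B R).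
      p (g w) = real (r w) / card K"
  proof (rule CE_inf_relabel_if_biorthogonal[OF contextuality_scenario_pair_scenario[OF BR(1-4)] g K(1)])
    show "K \<noteq> {}" using K by auto
  next
    fix e assume "e \<in> hedges (pair_scenario B R)"
    then obtain u v where e: "e = {(u, u), (v, v), (u, v)}" and uv: "(u, v) \<in> R"
      by (auto simp: pair_scenario_def)
    have ne: "u \<noteq> v" using uv BR(5) by (auto simp: irrefl_def)
    have "card ({u, v} \<inter> S) = of_bool (u \<in> S) + of_bool (v \<in> S)"
      using ne by (cases "u \<in> S"; cases "v \<in> S") auto
    then show "(\<Sum>w\<in>e. r w) = card K"
      using ne cardS[of u v] K by (simp add: e r_def)
    show "biorthogonal K (SIGMA w:e. {..<r w}) (\<lambda>(w, i). X w i) (\<lambda>(w, i). Y w i)"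
      unfolding biorthogonal_def
    proof (intro ballI)
      \<comment> \<open>Matches the indices of an edge with those of the extended system. It is
        injective there because a diagonal vertex has rank at most 1.\<close>
      define \<phi> :: "('b \<times> 'b) \<times> nat \<Rightarrow> 'b + nat"
        where "\<phi> = (\<lambda>((s, t), i). if s = t then Inl s else Inr i)"
      have \<phi>: "\<phi> a \<in> ({u, v} \<inter> S) <+> {..<?m u v}"
          "(case a of (w, i) \<Rightarrow> X w i) = case_sum x (x' u v) (\<phi> a)"
          "(case a of (w, i) \<Rightarrow> Y w i) = case_sum y (y' u v) (\<phi> a)"
        if "a \<in> (SIGMA w:e. {..<r w})" for a
        using that ne by (auto simp: e \<phi>_def r_def X_def Y_def of_bool_def split: if_splits)
      fix a b assume ab: "a \<in> (SIGMA w:e. {..<r w})" "b \<in> (SIGMA w:e. {..<r w})"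
      then have "\<phi> a = \<phi> b \<longleftrightarrow> a = b"
        using ne by (auto simp: e \<phi>_def r_def of_bool_def split: if_splits)
      then show "(\<Sum>c\<in>K. (case a of (w, i) \<Rightarrow> Y w i) c * (case b of (w, i) \<Rightarrow> X w i) c)
          = (if a = b then 1 else 0)"
        using biorthogonalD[OF ext[OF uv] \<phi>(1)[OF ab(1)] \<phi>(1)[OF ab(2)]]
        by (simp add: \<phi>(2,3) ab)
    qed
  qed
  then obtain p where p: "p \<in> CE_inf (relabel g (pair_scenario B R))"
    "\<And>w. w \<in> vertices (pair_scenario B R) \<Longrightarrow> p (g w) = real (r w) / card K"
    by blast
  have "p (g (u, u)) = (if u \<in> S then 1 / card K else 0)" if "u \<in> B" for u
    using p(2)[of "(u, u)"] Id_onI[OF that] by (simp add: pair_scenario_def r_def)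
  with p(1) show ?thesis by blast
qed

section \<open>Triples in a 16-element set and the failing midpoint\<close>

lemma sum_of_bool_mult:
  assumes "finite K" "A \<subseteq> K"
  shows "(\<Sum>c\<in>K. of_bool (c \<in> A) * of_bool (c \<in> B)) = (of_nat (card (A \<inter> B)) :: 'a::semiring_1)"
proof -
  have "(\<Sum>c\<in>K. of_bool (c \<in> A) * of_bool (c \<in> B)) = (\<Sum>c\<in>K. if c \<in> A \<inter> B then 1 else (0::'a))"
    by (intro sum.cong) auto
  also have "\<dots> = (\<Sum>c\<in>K \<inter> (A \<inter> B). 1)" using assms(1) by (simp only: sum.inter_restrict)
  also have "K \<inter> (A \<inter> B) = A \<inter> B" using assms(2) by blast
  finally show ?thesis by simp
qed

lemma of_nat_bit_eq: "(of_nat n :: bit) = of_bool (odd n)"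
  by (induction n) auto

text \<open>Distinct triples share at most two points. Thus those that are not A-orthogonal are
  B-orthogonal.\<close>

lemma card_inter_eq_1:
  assumes "card A = 3" "card B = 3" "A \<noteq> B" "odd (card (A \<inter> B))"
  shows "card (A \<inter> B) = 1"
proof -
  have fin: "finite A" "finite B" using assms by (auto intro: card_ge_0_finite)
  have "card (A \<inter> B) < card A"
  proof (rule psubset_card_mono[OF fin(1)])
    have "A \<inter> B \<noteq> A"
      using card_subset_eq[OF fin(2), of A] assms by auto
    then show "A \<inter> B \<subset> A" by blast
  qed
  with assms show ?thesis by (auto elim!: oddE)
qed

theorem theorem7p5p4:
  shows "\<exists>H :: nat hypergraph. contextuality_scenario H \<and> \<not> convex (CE_inf H)"
proof -
  let ?K = "{..<16::nat}"
  define T where "T = {A. A \<subseteq> ?K \<and> card A = 3}"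
  define B where "B = (UNIV :: bool set) \<times> T"
  \<comment> \<open>Tag \<open>False\<close> marks A-copies, related when the intersection is even;
    tag \<open>True\<close> marks B-copies, where odd means 1 as the triples are distinct. Copies
    with different tags are always related.\<close>
  define R where "R = {((s, A), (t, A')) | s A t A'. A \<in> T \<and> A' \<in> T \<and>
    (s = t \<longrightarrow> A \<noteq> A' \<and> (s \<longleftrightarrow> odd (card (A \<inter> A'))))}"
  have T: "finite T" "card T = 560"
    using n_subsets[of ?K 3] by (auto simp: T_def binomial_fact' fact_numeral)
  have BR: "finite B" "B \<noteq> {}" "R \<subseteq> B \<times> B" "B \<subseteq> Domain R" "irrefl R"
  proof -
    show "finite B" using T by (simp add: B_def)
    show "B \<noteq> {}" using T by (auto simp: B_def)
    show "R \<subseteq> B \<times> B" by (auto simp: B_def R_def)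
    show "irrefl R" by (auto simp: R_def irrefl_def)
    show "B \<subseteq> Domain R"
    proof
      fix u assume "u \<in> B"
      then have "(u, (\<not> fst u, snd u)) \<in> R" by (cases u) (auto simp: B_def R_def)
      then show "u \<in> Domain R" by blast
    qed
  qed
  let ?P = "pair_scenario B R"
  have P: "contextuality_scenario ?P" using contextuality_scenario_pair_scenario[OF BR(1-4)] .
  obtain g :: "_ \<Rightarrow> nat" where g: "inj_on g (vertices ?P)"
    using finite_imp_inj_to_nat_seg[OF scenarioD(1)[OF P]] by blast
  let ?H = "relabel g ?P"
  have H: "contextuality_scenario ?H" using contextuality_scenario_relabel[OF P] .
  \<comment> \<open>Over the two-element field the pairing is the parity of the intersection, and a
    triple has odd size.\<close>
  define x :: "bool \<times> nat set \<Rightarrow> nat \<Rightarrow> bit" where "x u c = of_bool (c \<in> snd u)" for u c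
  have bit: "biorthogonal ?K ({u, v} \<inter> {u. \<not> fst u}) x x" if "(u, v) \<in> R" for u v
  proof -
    have s: "(\<Sum>c\<in>?K. x a c * x b c) = of_bool (odd (card (snd a \<inter> snd b)))" if "snd a \<in> T" for a b
      unfolding x_def using that
      by (subst sum_of_bool_mult) (auto simp: T_def of_nat_bit_eq)
    show ?thesis
      unfolding biorthogonal_def
    proof (intro ballI)
      fix a b assume "a \<in> {u, v} \<inter> {u. \<not> fst u}" "b \<in> {u, v} \<inter> {u. \<not> fst u}"
      then have "snd a \<in> T" "odd (card (snd a \<inter> snd b)) \<longleftrightarrow> a = b"
        using that by (auto simp: R_def T_def Int_commute)
      then show "(\<Sum>c\<in>?K. x a c * x b c) = (if a = b then 1 else 0)"
        by (simp only: s of_bool_def)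
    qed
  qed
  define y :: "bool \<times> nat set \<Rightarrow> nat \<Rightarrow> real" where "y u c = of_bool (c \<in> snd u)" for u c
  \<comment> \<open>This form is 1 on triples with themselves and vanishes on triples with one common point.\<close>
  define z :: "bool \<times> nat set \<Rightarrow> nat \<Rightarrow> real" where "z u c = (of_bool (c \<in> snd u) - 1 / 3) / 2" for u c
  have real: "biorthogonal ?K ({u, v} \<inter> {u. fst u}) y z" if "(u, v) \<in> R" for u v
  proof -
    \<comment> \<open>Intersection size 3 is sent to 1 and size 1 to 0.\<close>
    have zy: "(\<Sum>c\<in>?K. z a c * y b c) = (real (card (snd a \<inter> snd b)) - 1) / 2"
      if "snd a \<in> T" "snd b \<in> T" for a b
    proof -
      \<comment> \<open>The coordinate sum of the 0/1 vector \<open>y b\<close> is written as its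
        pairing with itself, so that \<open>sum_of_bool_mult\<close> evaluates both sums.\<close>
      have "(\<Sum>c\<in>?K. z a c * y b c) =
          ((\<Sum>c\<in>?K. of_bool (c \<in> snd a) * of_bool (c \<in> snd b))
            - (\<Sum>c\<in>?K. of_bool (c \<in> snd b) * of_bool (c \<in> snd b)) / 3) / 2"
        unfolding z_def y_def sum_divide_distrib sum_subtractf[symmetric]
        by (intro sum.cong) (auto simp: field_simps)
      also have "\<dots> = (real (card (snd a \<inter> snd b)) - real (card (snd b \<inter> snd b)) / 3) / 2"
        using that by (subst (1 2) sum_of_bool_mult) (auto simp: T_def)
      finally show ?thesis using that by (simp add: T_def)
    qed
    have "card (A \<inter> A') = 1" if "A \<in> T" "A' \<in> T" "A \<noteq> A'" "odd (card (A \<inter> A'))" for A A'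
      using card_inter_eq_1 that by (auto simp: T_def)
    then show ?thesis
      using that by (auto simp: biorthogonal_def R_def zy Int_commute) (auto simp: T_def)
  qed
  obtain p0 where p0: "p0 \<in> CE_inf ?H" "\<And>u. u \<in> B \<Longrightarrow> p0 (g (u, u)) = (if \<not> fst u then 1 / 16 else 0)"
    using CE_inf_pair_scenario[OF BR g _ _ bit] by auto
  obtain p1 where p1: "p1 \<in> CE_inf ?H" "\<And>u. u \<in> B \<Longrightarrow> p1 (g (u, u)) = (if fst u then 1 / 16 else 0)"
    using CE_inf_pair_scenario[OF BR g _ _ real] by auto
  define p where "p = (1/2) *\<^sub>R p0 + (1/2) *\<^sub>R p1"
  have p: "p (g (u, u)) = 1 / 32" if "u \<in> B" for u
    using p0(2)[OF that] p1(2)[OF that] by (simp add: p_def plus_fun_def scaleR_fun_def)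
  \<comment> \<open>A copy followed by the opposite copy of the same triple; letting
    \<open>u\<close> range over \<open>B\<close> yields both orders.\<close>
  define w where "w = (\<lambda>u. [g (u, u), g ((\<not> fst u, snd u), (\<not> fst u, snd u))])"
  have flip: "(\<not> fst u, snd u) \<in> B" if "u \<in> B" for u using that by (auto simp: B_def)
  have diag: "(u, u) \<in> vertices ?P" if "u \<in> B" for u using that by (auto simp: pair_scenario_def)
  have winj: "inj_on w B"
  proof (rule inj_onI)
    fix u v assume "u \<in> B" "v \<in> B" "w u = w v"
    then have "(u, u) = (v, v)" by (intro inj_onD[OF g] diag) (simp_all add: w_def)
    then show "u = v" by simp
  qed
  have excl: "exclusive ?H (g (u, u)) (g (v, v))" if "(u, v) \<in> R" for u v
  proof -
    have "exclusive ?P (u, u) (v, v)"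
    proof (rule exclusiveI)
      show "{(u, u), (v, v), (u, v)} \<in> hedges ?P"
        using that by (force simp: pair_scenario_def)
      show "(u, u) \<noteq> (v, v)"
        using that BR(5) by (metis irreflD prod.inject)
    qed simp_all
    moreover have "u \<in> B" "v \<in> B" using that BR(3) by auto
    ultimately show ?thesis using exclusive_relabel[OF P g] diag by blast
  qed
  have "NO_independent (FR_power ?H 2) (w ` B)"
    unfolding NO_independent_iff
  proof (intro conjI ballI impI)
    show sub: "w ` B \<subseteq> vertices (FR_power ?H 2)"
      using diag flip by (auto simp: vertices_FR_power w_def relabel_def)
    fix a b assume ab: "a \<in> w ` B" "b \<in> w ` B" "a \<noteq> b"
    then obtain u v where uv: "u \<in> B" "v \<in> B" "a = w u" "b = w v" "u \<noteq> v" by auto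
    \<comment> \<open>With different tags the first letters are related. With equal tags the triples
      differ, and the parity of their intersection decides between first and second letters, whose
      tags are opposite.\<close>
    have "(u, v) \<in> R \<or> ((\<not> fst u, snd u), (\<not> fst v, snd v)) \<in> R"
      using uv(1,2,5) by (cases u; cases v) (auto simp: B_def R_def)
    then have "exclusive ?H (a ! 0) (b ! 0) \<or> exclusive ?H (a ! 1) (b ! 1)"
      using excl[of u v] excl[of "(\<not> fst u, snd u)" "(\<not> fst v, snd v)"] by (auto simp: uv w_def)
    moreover have "a \<in> vertices (FR_power ?H 2)" "b \<in> vertices (FR_power ?H 2)" using ab sub by blast+
    ultimately show "exclusive (FR_power ?H 2) a b"
      using exclusive_FR_power[OF H] by (metis one_less_numeral_iff pos2 semiring_norm(76))
  qed
  moreover have "(\<Sum>vs\<in>w ` B. model_power p 2 vs) > 1"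
  proof -
    have "(\<Sum>vs\<in>w ` B. model_power p 2 vs) = (\<Sum>u\<in>B. model_power p 2 (w u))"
      by (simp add: sum.reindex[OF winj])
    \<comment> \<open>Each word has weight \<open>(1/32)^2\<close>, and there are
      \<open>2 * 560 = 1120\<close> words.\<close>
    also have "\<dots> = (\<Sum>u\<in>B. 1 / 1024)"
      by (intro sum.cong) (simp_all add: p flip model_power_def w_def numeral_2_eq_2)
    also have "\<dots> = 1120 / 1024" using T by (simp add: B_def card_cartesian_product)
    finally show ?thesis by simp
  qed
  ultimately have "p \<notin> CE 2 ?H"
    by (auto simp: CE_def CE1_def not_le)
  then have "p \<notin> CE_inf ?H"
    by (auto simp: CE_inf_def)
  then have "\<not> convex (CE_inf ?H)"
    using convexD[OF _ p0(1) p1(1), of "1/2" "1/2"] by (auto simp: p_def)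
  with H show ?thesis by blast
qed

end
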